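(* Let $\mathcal{F}$ be a family of analytic functions on a domain $D\subset\mathbb{C}$ such that the family of derivatives $\mathcal{F}'=\{f':f\in\mathcal{F}\}$ satisfies: (1) there is a fixed $\epsilon>0$ such that $|f'(z)|\geq\epsilon$ for all $z\in D$ and all $f\in\mathcal{F}$; (2) the family $\mathcal{F}'$ is locally bounded on $D$. Then the family of Schwarzian derivatives $\{S_f:f\in\mathcal{F}\}$ is normal on $D$.
   Context: The Schwarzian derivative of $f$ is $S_f(z)=\frac{f'''(z)}{f'(z)}-\frac{3}{2}\left(\frac{f''(z)}{f'(z)}\right)^2$. A family of analytic functions on a domain $D$ is locally bounded on $D$ if it is uniformly bounded (by a constant independent of the member of the family) on each compact subset of $D$. A family of meromorphic functions (in particular, of analytic functions) is normal on $D$ if every sequence in the family has a subsequence converging locally uniformly on $D$ with respect to the spherical metric (the limit $\infty$ being allowed). *)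

theory Defs
  imports "HOL-Complex_Analysis.Complex_Analysis"
begin

definition schwarzian :: "(complex \<Rightarrow> complex) \<Rightarrow> complex \<Rightarrow> complex" where
  "schwarzian f z =
     (deriv ^^ 3) f z / deriv f z - 3 / 2 * ((deriv ^^ 2) f z / deriv f z)\<^sup>2"

definition locally_bounded_family :: "complex set \<Rightarrow> (complex \<Rightarrow> complex) set \<Rightarrow> bool" where
  "locally_bounded_family D \<F> \<longleftrightarrow>
     (\<forall>K. compact K \<and> K \<subseteq> D \<longrightarrow> (\<exists>M. \<forall>f\<in>\<F>. \<forall>z\<in>K. norm (f z) \<le> M))"

datatype riemann_sphere = Finite_Point complex | Infinity_Point

text \<open>Length of the chord between the stereographic images of two points on the unit sphere.\<close>

fun chordal_dist :: "riemann_sphere \<Rightarrow> riemann_sphere \<Rightarrow> real" where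
  "chordal_dist (Finite_Point z) (Finite_Point w) =
     2 * norm (z - w) / (sqrt (1 + (norm z)\<^sup>2) * sqrt (1 + (norm w)\<^sup>2))"
| "chordal_dist (Finite_Point z) Infinity_Point = 2 / sqrt (1 + (norm z)\<^sup>2)"
| "chordal_dist Infinity_Point (Finite_Point w) = 2 / sqrt (1 + (norm w)\<^sup>2)"
| "chordal_dist Infinity_Point Infinity_Point = 0"

text \<open>Great-circle distance on the unit sphere: a chord of length \<open>c\<close> subtends the angle
  \<open>2 * arcsin (c / 2)\<close>. This is the geodesic distance of the metric \<open>2|dz| / (1 + |z|^2)\<close>.\<close>

definition spherical_dist :: "riemann_sphere \<Rightarrow> riemann_sphere \<Rightarrow> real" where
  "spherical_dist p q = 2 * arcsin (chordal_dist p q / 2)"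

text \<open>The library represents meromorphic functions as functions into the complex numbers,
  with a junk value at the poles; here the poles get the value infinity.\<close>

definition sphere_valued :: "(complex \<Rightarrow> complex) \<Rightarrow> complex \<Rightarrow> riemann_sphere" where
  "sphere_valued f z = (if is_pole f z then Infinity_Point else Finite_Point (f z))"

definition spherically_uniform_limit ::
    "complex set \<Rightarrow> (nat \<Rightarrow> complex \<Rightarrow> riemann_sphere) \<Rightarrow> (complex \<Rightarrow> riemann_sphere) \<Rightarrow> bool" where
  "spherically_uniform_limit U h g \<longleftrightarrow>
     (\<forall>e>0. \<forall>\<^sub>F n in sequentially. \<forall>z\<in>U. spherical_dist (h n z) (g z) < e)"

definition spherically_locally_uniform_limit ::
    "complex set \<Rightarrow> (nat \<Rightarrow> complex \<Rightarrow> riemann_sphere) \<Rightarrow> (complex \<Rightarrow> riemann_sphere) \<Rightarrow> bool" where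
  "spherically_locally_uniform_limit D h g \<longleftrightarrow>
     (\<forall>z\<in>D. \<exists>U. open U \<and> z \<in> U \<and> U \<subseteq> D \<and> spherically_uniform_limit U h g)"

text \<open>The limit function \<open>g\<close> is sphere-valued, so it may be identically infinity.
  \<open>nicely_meromorphic_on\<close> excludes wrong values at removable singularities.\<close>

definition normal_family :: "complex set \<Rightarrow> (complex \<Rightarrow> complex) set \<Rightarrow> bool" where
  "normal_family D \<G> \<longleftrightarrow>
     (\<forall>f\<in>\<G>. f nicely_meromorphic_on D) \<and>
     (\<forall>h :: nat \<Rightarrow> complex \<Rightarrow> complex. (\<forall>n. h n \<in> \<G>) \<longrightarrow>
        (\<exists>r :: nat \<Rightarrow> nat. strict_mono r \<and>
          (\<exists>g. spherically_locally_uniform_limit D (\<lambda>n. sphere_valued (h (r n))) g)))"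

end

theory Submission
  imports Defs
begin

text \<open>Cauchy's estimates make the families of second and third derivatives locally bounded. Together
  with \<open>norm (deriv f z) \<ge> \<epsilon>\<close> this bounds the Schwarzians locally, so Montel's theorem applies; for
  functions without poles, locally uniform convergence in the plane implies spherical convergence.\<close>

text \<open>Cauchy's estimate bounds a derivative at a point by the values on a circle around it. A
  positive radius \<open>d\<close> can be chosen for all of \<open>K\<close> at once, and the closed
  \<open>d\<close>-neighbourhood of \<open>K\<close> is again a compact subset of \<open>D\<close>,
  so one bound \<open>M\<close> there serves every circle.\<close>

lemma locally_bounded_family_deriv:
  assumes "open D" and hol: "\<And>g. g \<in> \<G> \<Longrightarrow> g holomorphic_on D"
    and bdd: "locally_bounded_family D \<G>"
  shows "locally_bounded_family D (deriv ` \<G>)"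
  unfolding locally_bounded_family_def
proof (intro allI impI)
  fix K assume K: "compact K \<and> K \<subseteq> D"
  then obtain d where d: "d > 0" "(\<Union>x\<in>K. cball x d) \<subseteq> D"
    using compact_subset_open_imp_cball_epsilon_subset[of K D] \<open>open D\<close> by blast
  have "compact (\<Union>x\<in>K. cball x d)"
    using compact_minkowski_sum_cball K by blast
  then obtain M where M: "\<And>g z. g \<in> \<G> \<Longrightarrow> z \<in> (\<Union>x\<in>K. cball x d) \<Longrightarrow> norm (g z) \<le> M"
    using bdd d(2) unfolding locally_bounded_family_def by meson
  have "norm (deriv g z) \<le> M / d" if "g \<in> \<G>" "z \<in> K" for g z
  proof -
    have "cball z d \<subseteq> D" using d(2) \<open>z \<in> K\<close> by blast
    then have h: "g holomorphic_on cball z d"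
      using hol[OF \<open>g \<in> \<G>\<close>] holomorphic_on_subset by blast
    \<comment> \<open>This is Cauchy's estimate of order one, kept in the general form so that the
      library rule unifies.\<close>
    have "norm ((deriv ^^ 1) g z) \<le> fact 1 * M / d ^ 1"
    proof (rule Cauchy_inequality)
      show "g holomorphic_on ball z d"
        using h ball_subset_cball holomorphic_on_subset by blast
      show "continuous_on (cball z d) g"
        using h by (rule holomorphic_on_imp_continuous_on)
      show "norm (g w) \<le> M" if "norm (z - w) = d" for w
        using M[OF \<open>g \<in> \<G>\<close>, of w] that \<open>z \<in> K\<close> by (auto simp: dist_norm)
    qed (use d in auto)
    then show ?thesis by simp
  qed
  then show "\<exists>M. \<forall>f\<in>deriv ` \<G>. \<forall>z\<in>K. norm (f z) \<le> M" by blast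
qed

text \<open>The denominator of the chordal distance is at least 1, so the Euclidean distance
  dominates half the chord, and \<open>arcsin\<close> is continuous at 0 with value 0. As
  \<open>\<delta>\<close> depends on \<open>e\<close> alone, uniform convergence in the plane passes
  to the sphere.\<close>

lemma spherical_dist_Finite_Point_uniform:
  assumes "e > 0"
  obtains \<delta> where "\<delta> > 0"
    "\<And>z w. norm (z - w) < \<delta> \<Longrightarrow> spherical_dist (Finite_Point z) (Finite_Point w) < e"
proof -
  have "\<forall>e>0. \<exists>\<delta>>0. \<forall>t. \<bar>t\<bar> < \<delta> \<longrightarrow> \<bar>arcsin t\<bar> < e"
    using isCont_arcsin[of 0] by (simp add: continuous_at_eps_delta dist_norm)
  \<comment> \<open>Taking \<open>e / 2\<close> absorbs the factor 2 in front of
    \<open>arcsin\<close>; the 2 in the chord cancels against the division by 2.\<close>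
  then obtain \<delta> where "\<delta> > 0" and \<delta>: "\<And>t. \<bar>t\<bar> < \<delta> \<Longrightarrow> \<bar>arcsin t\<bar> < e / 2"
    using assms half_gt_zero by blast
  have "spherical_dist (Finite_Point z) (Finite_Point w) < e" if "norm (z - w) < \<delta>" for z w
  proof -
    define p where "p = sqrt (1 + (norm z)\<^sup>2) * sqrt (1 + (norm w)\<^sup>2)"
    have "1 \<le> p" unfolding p_def
      using mult_mono[of 1 "sqrt (1 + (norm z)\<^sup>2)" 1 "sqrt (1 + (norm w)\<^sup>2)"] by simp
    then have "norm (z - w) / p \<le> norm (z - w)"
      by (simp add: divide_le_eq mult_le_cancel_left1)
    then have "\<bar>norm (z - w) / p\<bar> < \<delta>"
      using that \<open>1 \<le> p\<close> by simp
    from \<delta>[OF this] show ?thesis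
      by (simp add: spherical_dist_def p_def)
  qed
  with \<open>\<delta> > 0\<close> show thesis using that by blast
qed

lemma sphere_valued_holomorphic:
  assumes "f holomorphic_on D" "open D" "z \<in> D"
  shows "sphere_valued f z = Finite_Point (f z)"
  using assms not_is_pole_holomorphic by (auto simp: sphere_valued_def)

text \<open>Local boundedness confines the limits to the plane: Montel's theorem supplies a
  complex-valued \<open>g\<close>, so the spherical limit never takes the value infinity.\<close>

lemma normal_family_locally_bounded:
  assumes "open D" and hol: "\<And>f. f \<in> \<G> \<Longrightarrow> f holomorphic_on D"
    and bdd: "locally_bounded_family D \<G>"
  shows "normal_family D \<G>"
  unfolding normal_family_def
proof (intro conjI ballI allI impI)
  fix f assume "f \<in> \<G>"
  then show "f nicely_meromorphic_on D"
    using hol \<open>open D\<close> by (simp add: analytic_on_imp_nicely_meromorphic_on analytic_on_open)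
next
  fix h :: "nat \<Rightarrow> complex \<Rightarrow> complex" assume h: "\<forall>n. h n \<in> \<G>"
  then have "range h \<subseteq> \<G>" by blast
  then obtain g r where r: "strict_mono (r :: nat \<Rightarrow> nat)"
    and lim: "\<And>K. compact K \<Longrightarrow> K \<subseteq> D \<Longrightarrow> uniform_limit K (h \<circ> r) g sequentially"
    using Montel[OF \<open>open D\<close> hol, of \<G> h] bdd unfolding locally_bounded_family_def by metis
  have "spherically_locally_uniform_limit D (\<lambda>n. sphere_valued (h (r n)))
          (\<lambda>z. Finite_Point (g z))"
    unfolding spherically_locally_uniform_limit_def
  proof
    fix z assume "z \<in> D"
    \<comment> \<open>Montel's theorem gives uniformity on compact sets, while the definition asks
      for an open neighbourhood. Convergence on \<open>cball z d\<close> is therefore restricted to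
      \<open>ball z d\<close>.\<close>
    then obtain d where d: "d > 0" "cball z d \<subseteq> D"
      using \<open>open D\<close> open_contains_cball by blast
    have "spherically_uniform_limit (ball z d) (\<lambda>n. sphere_valued (h (r n)))
            (\<lambda>z. Finite_Point (g z))"
      unfolding spherically_uniform_limit_def
    proof (intro allI impI)
      fix e :: real assume "e > 0"
      then obtain \<delta> where "\<delta> > 0" and \<delta>: "\<And>z w. norm (z - w) < \<delta> \<Longrightarrow>
          spherical_dist (Finite_Point z) (Finite_Point w) < e"
        using spherical_dist_Finite_Point_uniform by blast
      have "\<forall>\<^sub>F n in sequentially. \<forall>w\<in>cball z d. dist ((h \<circ> r) n w) (g w) < \<delta>"
        using lim[OF compact_cball d(2)] \<open>\<delta> > 0\<close> by (rule uniform_limitD)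
      then show "\<forall>\<^sub>F n in sequentially. \<forall>w\<in>ball z d.
          spherical_dist (sphere_valued (h (r n)) w) (Finite_Point (g w)) < e"
      proof eventually_elim
        case (elim n)
        show ?case
        proof
          fix w assume "w \<in> ball z d"
          then have w: "w \<in> cball z d" by simp
          then have "sphere_valued (h (r n)) w = Finite_Point (h (r n) w)"
            using d(2) h hol \<open>open D\<close> by (meson sphere_valued_holomorphic subsetD)
          then show "spherical_dist (sphere_valued (h (r n)) w) (Finite_Point (g w)) < e"
            using elim w \<delta> by (simp add: dist_norm)
        qed
      qed
    qed
    then show "\<exists>U. open U \<and> z \<in> U \<and> U \<subseteq> D \<and> spherically_uniform_limit U
        (\<lambda>n. sphere_valued (h (r n))) (\<lambda>z. Finite_Point (g z))"
      using d by (intro exI[of _ "ball z d"]) auto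
  qed
  with r show "\<exists>r. strict_mono r \<and>
      (\<exists>g. spherically_locally_uniform_limit D (\<lambda>n. sphere_valued (h (r n))) g)"
    by blast
qed

lemma schwarzian_holomorphic_on:
  assumes "f holomorphic_on D" "open D" "\<And>z. z \<in> D \<Longrightarrow> deriv f z \<noteq> 0"
  shows "schwarzian f holomorphic_on D"
proof -
  have "(\<lambda>z. (deriv ^^ 3) f z / deriv f z - 3 / 2 * ((deriv ^^ 2) f z / deriv f z)\<^sup>2)
      holomorphic_on D"
    using assms by (intro holomorphic_intros holomorphic_higher_deriv holomorphic_deriv) auto
  then show ?thesis by (simp add: schwarzian_def [abs_def])
qed

theorem theorem2p3:
  fixes D :: "complex set" and \<F> :: "(complex \<Rightarrow> complex) set" and \<epsilon> :: real
  assumes "open D" and "connected D" and "D \<noteq> {}"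
    and "\<And>f. f \<in> \<F> \<Longrightarrow> f analytic_on D"
    and "\<epsilon> > 0"
    and "\<And>f z. f \<in> \<F> \<Longrightarrow> z \<in> D \<Longrightarrow> norm (deriv f z) \<ge> \<epsilon>"
    and "locally_bounded_family D (deriv ` \<F>)"
  shows "normal_family D (schwarzian ` \<F>)"
proof (rule normal_family_locally_bounded [OF \<open>open D\<close>])
  have hol: "f holomorphic_on D" if "f \<in> \<F>" for f
    using assms(4) [OF that] by (rule analytic_imp_holomorphic)
  \<comment> \<open>The lower bound \<open>\<epsilon> > 0\<close> keeps \<open>deriv f\<close> from
    vanishing, so the quotients in the Schwarzian have no poles in \<open>D\<close>.\<close>
  show "g holomorphic_on D" if "g \<in> schwarzian ` \<F>" for g
    using that hol assms(1,5,6) by (force intro!: schwarzian_holomorphic_on)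
  have bdd2: "locally_bounded_family D (deriv ` deriv ` \<F>)"
    using assms(1) hol
    by (intro locally_bounded_family_deriv [OF _ _ assms(7)]) (auto intro: holomorphic_deriv)
  have bdd3: "locally_bounded_family D (deriv ` deriv ` deriv ` \<F>)"
    using assms(1) hol
    by (intro locally_bounded_family_deriv [OF _ _ bdd2]) (auto intro: holomorphic_deriv)
  show "locally_bounded_family D (schwarzian ` \<F>)"
    unfolding locally_bounded_family_def
  proof (intro allI impI)
    fix K assume K: "compact K \<and> K \<subseteq> D"
    obtain A where A: "\<And>f z. f \<in> \<F> \<Longrightarrow> z \<in> K \<Longrightarrow> norm (deriv (deriv f) z) \<le> A"
      using bdd2 K unfolding locally_bounded_family_def by (metis imageI)
    obtain B where B: "\<And>f z. f \<in> \<F> \<Longrightarrow> z \<in> K \<Longrightarrow> norm (deriv (deriv (deriv f)) z) \<le> B"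
      using bdd3 K unfolding locally_bounded_family_def by (metis imageI)
    \<comment> \<open>On \<open>K\<close> the quotients f'''/f' and f''/f' are at most
      B/\<open>\<epsilon>\<close> and A/\<open>\<epsilon>\<close> in modulus; the triangle
      inequality combines them into a constant independent of \<open>f\<close> and
      \<open>z\<close>.\<close>
    have "norm (schwarzian f z) \<le> B / \<epsilon> + 3 / 2 * (A / \<epsilon>)\<^sup>2" if "f \<in> \<F>" "z \<in> K" for f z
    proof -
      have quot: "norm (x / deriv f z) \<le> C / \<epsilon>" if "norm x \<le> C" for x C
        using that assms(5,6) \<open>f \<in> \<F>\<close> \<open>z \<in> K\<close> K unfolding norm_divide
        by (intro frac_le) (auto intro: order_trans[OF norm_ge_zero])
      have "norm (schwarzian f z) \<le> norm (deriv (deriv (deriv f)) z / deriv f z)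
          + norm (3 / 2 * (deriv (deriv f) z / deriv f z)\<^sup>2)"
        \<comment> \<open>Writing 3 and 2 as successors turns the iterates \<open>deriv ^^ 3\<close>
          and \<open>deriv ^^ 2\<close> into the nested derivatives that \<open>A\<close> and
          \<open>B\<close> bound.\<close>
        unfolding schwarzian_def by (simp add: numeral_3_eq_3 numeral_2_eq_2 norm_triangle_ineq4)
      also have "norm (3 / 2 * (deriv (deriv f) z / deriv f z)\<^sup>2)
          = 3 / 2 * (norm (deriv (deriv f) z / deriv f z))\<^sup>2"
        by (simp only: norm_mult norm_power) simp
      also have "norm (deriv (deriv (deriv f)) z / deriv f z) + \<dots> \<le> B / \<epsilon> + 3 / 2 * (A / \<epsilon>)\<^sup>2"
        by (intro add_mono mult_left_mono power_mono quot A B that) auto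
      finally show ?thesis .
    qed
    then show "\<exists>M. \<forall>g\<in>schwarzian ` \<F>. \<forall>z\<in>K. norm (g z) \<le> M" by blast
  qed
qed

end
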